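(* Let $K$ be a field and let $(V,c)$ be a braided vector space over $K$. Assume that $c$ is a root of a polynomial $f\in K[X]$ having $-1$ as a simple root, and write $f=(X+1)h$ with $h\in K[X]$ (so $h(-1)\neq0$). Then the assignment $\overline\beta\mapsto\overline\beta\, h(c)$ yields a bijection between the set $$\overline B=\{\overline\beta:E_2(V,c)\to V\mid (V,c,\overline\beta)\text{ is a QLie algebra}\}$$ and the set $$B=\{\beta:V\otimes V\to V\mid (V,c,\beta)\text{ is a lifted QLie algebra}\}.$$
   Context: All vector spaces and tensor products are over $K$; all maps are $K$-linear. A braided vector space $(V,c)$ is a vector space $V$ with a linear map $c:V\otimes V\to V\otimes V$ satisfying $c_1c_2c_1=c_2c_1c_2$ on $V^{\otimes 3}$, where $c_1=c\otimes \mathrm{Id}_V$, $c_2=\mathrm{Id}_V\otimes c$. Saying that $c$ is a root of $f$ means $f(c)=0$ in $\mathrm{End}(V\otimes V)$. For a map $\beta$ defined on (a subspace of) $V\otimes V$ with values in $V$, $\beta_1=\beta\otimes\mathrm{Id}_V$ and $\beta_2=\mathrm{Id}_V\otimes\beta$. $E_2(V,c)=\ker(c+\mathrm{Id}_{V^{\otimes2}})$ and $\overline{E_2(V,c)}=(E_2(V,c)\otimes V)\cap(V\otimes E_2(V,c))=\{z\in V^{\otimes3}\mid c_1(z)=-z=c_2(z)\}$. Let $c_{E_2(V,c),V}:E_2(V,c)\otimes V\to V\otimes E_2(V,c)$ be the restriction of $c_1c_2$ and $c_{V,E_2(V,c)}:V\otimes E_2(V,c)\to E_2(V,c)\otimes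 V$ the restriction of $c_2c_1$. $(V,c,\overline\beta)$, with $\overline\beta:E_2(V,c)\to V$, is a QLie algebra if $c\overline\beta_1=\overline\beta_2c_{E_2(V,c),V}$, $c\overline\beta_2=\overline\beta_1c_{V,E_2(V,c)}$, and $\overline\beta(\overline\beta_1-\overline\beta_2)(\overline{E_2(V,c)})=0$ (the first two conditions imply $(\overline\beta_1-\overline\beta_2)(\overline{E_2(V,c)})\subseteq E_2(V,c)$, so the last one makes sense). $(V,c,\beta)$, with $\beta:V\otimes V\to V$, is a lifted QLie algebra if $c\beta_1=\beta_2c_1c_2$, $c\beta_2=\beta_1c_2c_1$, $\beta(\beta_1-\beta_2)(\overline{E_2(V,c)})=0$ and $\beta c=-\beta$. Since $f(c)=(c+\mathrm{Id})h(c)=0$, the image of $h(c)$ lies in $E_2(V,c)$, so $\overline\beta h(c):V\otimes V\to V$ is defined. *)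

theory Defs
  imports
    "HOL-Library.Function_Algebras"
    "HOL-Library.FuncSet"
    "HOL-Computational_Algebra.Polynomial"
begin

text \<open>
  Linear maps from a subspace \<open>A\<close> to a subspace \<open>W\<close>. They are extensional, so that two of them
  are equal as HOL functions iff they agree on \<open>A\<close>.
\<close>

definition lin_maps ::
  "('k \<Rightarrow> 'a::ab_group_add \<Rightarrow> 'a) \<Rightarrow> ('k \<Rightarrow> 'b::ab_group_add \<Rightarrow> 'b) \<Rightarrow> 'a set \<Rightarrow> 'b set \<Rightarrow> ('a \<Rightarrow> 'b) set"
  where "lin_maps s t A W = {f \<in> A \<rightarrow>\<^sub>E W.
    (\<forall>x\<in>A. \<forall>y\<in>A. f (x + y) = f x + f y) \<and> (\<forall>a. \<forall>x\<in>A. f (s a x) = t a (f x))}"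

section \<open>Tensor powers\<close>

text \<open>
  For \<open>s\<close> the scalar multiplication of a vector space \<open>V\<close> (the type \<open>'v\<close>) over the field \<open>'k\<close>,
  the tensor \<open>v\<^sub>1 \<otimes> \<dots> \<otimes> v\<^sub>n\<close> is the evaluation functional \<open>B \<mapsto> B [v\<^sub>1, \<dots>, v\<^sub>n]\<close> on multilinear
  forms, and \<open>V\<^sup>\<otimes>\<^sup>n\<close> is the span of these functionals. This is the usual realisation of the algebraic
  tensor product inside the dual of the space of multilinear forms; no finiteness of dimension is
  involved, and the universal property for arbitrary target spaces is \<open>tensor_power_universal\<close>
  below. A form is a function on lists of all lengths, linear in every slot; tensors take
  the value \<open>0\<close> on functions that are not of this kind. All tensor powers live in one
  type, where the tensor product of tensors is strictly associative.
\<close>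

type_synonym ('k, 'v) tensor = "('v list \<Rightarrow> 'k) \<Rightarrow> 'k"

definition multilinear_form :: "('k::field \<Rightarrow> 'v::ab_group_add \<Rightarrow> 'v) \<Rightarrow> ('v list \<Rightarrow> 'k) \<Rightarrow> bool"
  where "multilinear_form s B \<longleftrightarrow> (\<forall>xs ys. Vector_Spaces.linear s (*) (\<lambda>v. B (xs @ v # ys)))"

definition tscale :: "'k::field \<Rightarrow> ('k, 'v) tensor \<Rightarrow> ('k, 'v) tensor"
  where "tscale a S = (\<lambda>B. a * S B)"

definition pure_tensor :: "('k::field \<Rightarrow> 'v::ab_group_add \<Rightarrow> 'v) \<Rightarrow> 'v list \<Rightarrow> ('k, 'v) tensor"
  where "pure_tensor s vs = (\<lambda>B. if multilinear_form s B then B vs else 0)"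

definition tensor_power :: "('k::field \<Rightarrow> 'v::ab_group_add \<Rightarrow> 'v) \<Rightarrow> nat \<Rightarrow> ('k, 'v) tensor set"
  where "tensor_power s n = module.span tscale (pure_tensor s ` {vs. length vs = n})"

text \<open>The canonical isomorphism from \<open>V\<close> onto \<open>V\<^sup>\<otimes>\<^sup>1\<close>.\<close>

definition vec :: "('k::field \<Rightarrow> 'v::ab_group_add \<Rightarrow> 'v) \<Rightarrow> 'v \<Rightarrow> ('k, 'v) tensor"
  where "vec s v = pure_tensor s [v]"

text \<open>The tensor product of tensors; it concatenates pure tensors, see \<open>tprod_pure\<close>.\<close>

definition tprod ::
  "('k::field \<Rightarrow> 'v::ab_group_add \<Rightarrow> 'v) \<Rightarrow> ('k, 'v) tensor \<Rightarrow> ('k, 'v) tensor \<Rightarrow> ('k, 'v) tensor"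
  where "tprod s S T =
    (\<lambda>B. if multilinear_form s B then S (\<lambda>xs. T (\<lambda>ys. B (xs @ ys))) else 0)"

text \<open>\<open>A \<otimes> C\<close> as a subspace of \<open>V\<^sup>\<otimes>\<^sup>(\<^sup>m\<^sup>+\<^sup>n\<^sup>)\<close>, for subspaces \<open>A\<close> of \<open>V\<^sup>\<otimes>\<^sup>m\<close> and \<open>C\<close> of \<open>V\<^sup>\<otimes>\<^sup>n\<close>.\<close>

definition tensor_sub ::
  "('k::field \<Rightarrow> 'v::ab_group_add \<Rightarrow> 'v) \<Rightarrow> ('k, 'v) tensor set \<Rightarrow> ('k, 'v) tensor set \<Rightarrow> ('k, 'v) tensor set"
  where "tensor_sub s A C = module.span tscale {tprod s S T | S T. S \<in> A \<and> T \<in> C}"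

text \<open>
  The linear map \<open>f \<otimes> g\<close> on \<open>A \<otimes> C\<close>. For linear maps between subspaces of tensor powers it exists
  and is unique, see \<open>tensor_map_ex1\<close>.
\<close>

definition tensor_map ::
  "('k::field \<Rightarrow> 'v::ab_group_add \<Rightarrow> 'v) \<Rightarrow> ('k, 'v) tensor set \<Rightarrow> ('k, 'v) tensor set \<Rightarrow>
   (('k, 'v) tensor \<Rightarrow> ('k, 'v) tensor) \<Rightarrow> (('k, 'v) tensor \<Rightarrow> ('k, 'v) tensor) \<Rightarrow>
   ('k, 'v) tensor \<Rightarrow> ('k, 'v) tensor"
  where "tensor_map s A C f g = (THE h. h \<in> lin_maps tscale tscale (tensor_sub s A C) UNIV \<and>
    (\<forall>S\<in>A. \<forall>T\<in>C. h (tprod s S T) = tprod s (f S) (g T)))"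

subsection \<open>The universal property, and existence of tensor products of maps\<close>

lemma vector_space_tscale: "vector_space (tscale :: 'k::field \<Rightarrow> ('k, 'v) tensor \<Rightarrow> _)"
  by unfold_locales (auto simp: tscale_def fun_eq_iff algebra_simps)

lemma vector_space_mult: "vector_space ((*) :: 'k::field \<Rightarrow> 'k \<Rightarrow> 'k)"
  by unfold_locales (auto simp: algebra_simps)

lemma lin_maps_extend:
  assumes "vector_space s" "vector_space t" "module.subspace s A" "module.subspace t W"
    and f: "f \<in> lin_maps s t A W"
  shows "\<exists>F. Vector_Spaces.linear s t F \<and> (\<forall>x\<in>A. F x = f x) \<and> range F \<subseteq> W"
proof -
  interpret vector_space_pair s t
    using assms by (simp add: vector_space_pair_def)
  obtain B where B: "B \<subseteq> A" "vs1.independent B" "A \<subseteq> vs1.span B"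
    using vs1.maximal_independent_subset[of A] by blast
  obtain F where F: "Vector_Spaces.linear s t F" "\<forall>x\<in>B. F x = f x" "range F = vs2.span (f ` B)"
    using linear_independent_extend_subspace[OF B(2), of f] by blast
  interpret F: Vector_Spaces.linear s t F by fact
  have sub: "vs1.subspace A" "vs2.subspace W" using assms by auto
  have "x \<in> A \<and> F x = f x" if "x \<in> vs1.span B" for x
    using that
  proof (induction rule: vs1.span_induct_alt)
    case base
    have "0 \<in> A" using sub vs1.subspace_0 by blast
    moreover have "f (s 0 0) = t 0 (f 0)" using f \<open>0 \<in> A\<close> unfolding lin_maps_def by blast
    ultimately show ?case by (simp add: F.zero)
  next
    case (step c x y)
    then have "s c x \<in> A" "x \<in> A" using B sub vs1.subspace_scale by blast+
    with step f show ?case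
      using F(2) sub by (auto simp: F.add F.scale lin_maps_def vs1.subspace_add)
  qed
  moreover have "vs2.span (f ` B) \<subseteq> W"
    using f B sub by (intro vs2.span_minimal) (auto simp: lin_maps_def)
  ultimately show ?thesis using F B by (intro exI[of _ F]) auto
qed

lemma lin_maps_eq_on_span:
  assumes "vector_space s" "vector_space t"
    and "f \<in> lin_maps s t (module.span s X) UNIV" "g \<in> lin_maps s t (module.span s X) UNIV"
    and "\<And>x. x \<in> X \<Longrightarrow> f x = g x"
  shows "f = g"
proof -
  interpret vector_space_pair s t
    using assms by (simp add: vector_space_pair_def)
  have "x \<in> vs1.span X \<and> f x = g x" if "x \<in> vs1.span X" for x
    using that
  proof (induction rule: vs1.span_induct_alt)
    case base
    have "f (s 0 0) = t 0 (f 0)" "g (s 0 0) = t 0 (g 0)"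
      using assms vs1.span_zero[of X] unfolding lin_maps_def by blast+
    then show ?case by (simp add: vs1.span_zero)
  next
    case (step c x y)
    then have "x \<in> vs1.span X" "s c x \<in> vs1.span X"
      by (auto intro: vs1.span_base vs1.span_scale)
    with step assms(3-5) show ?case by (auto simp: lin_maps_def vs1.span_add)
  qed
  then show ?thesis
    using assms(3,4) by (intro extensionalityI[of _ "module.span s X"]) (auto simp: lin_maps_def PiE_def)
qed

lemma tensor_power_universal:
  fixes s :: "'k::field \<Rightarrow> 'v::ab_group_add \<Rightarrow> 'v" and t :: "'k \<Rightarrow> 'w::ab_group_add \<Rightarrow> 'w"
  assumes "vector_space s" "vector_space t"
    and g: "\<And>xs ys. length xs + length ys + 1 = n \<Longrightarrow> Vector_Spaces.linear s t (\<lambda>v. g (xs @ v # ys))"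
  shows "\<exists>!f. f \<in> lin_maps tscale t (tensor_power s n) UNIV \<and>
              (\<forall>vs. length vs = n \<longrightarrow> f (pure_tensor s vs) = g vs)"
proof -
  let ?X = "pure_tensor s ` {vs. length vs = n}"
  interpret T: vector_space "tscale :: 'k \<Rightarrow> ('k, 'v) tensor \<Rightarrow> _" by (rule vector_space_tscale)
  interpret V: vector_space s by fact
  interpret P: vector_space_pair "tscale :: 'k \<Rightarrow> ('k, 'v) tensor \<Rightarrow> _" t
    using assms by (simp add: vector_space_pair_def vector_space_tscale)
  interpret Q: vector_space_pair t "(*) :: 'k \<Rightarrow> 'k \<Rightarrow> 'k"
    using assms by (simp add: vector_space_pair_def vector_space_mult)
  obtain B where B: "B \<subseteq> ?X" "T.independent B" "?X \<subseteq> T.span B"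
    using T.maximal_independent_subset[of ?X] by blast
  define r where "r b = (SOME vs. length vs = n \<and> b = pure_tensor s vs)" for b :: "('k, 'v) tensor"
  have r: "length (r b) = n" "b = pure_tensor s (r b)" if "b \<in> B" for b
  proof -
    have "\<exists>vs. length vs = n \<and> b = pure_tensor s vs" using B that by auto
    then have "length (r b) = n \<and> b = pure_tensor s (r b)" unfolding r_def by (rule someI_ex)
    then show "length (r b) = n" "b = pure_tensor s (r b)" by auto
  qed
  obtain F where F: "Vector_Spaces.linear tscale t F" "\<forall>b\<in>B. F b = g (r b)"
    using P.linear_independent_extend[OF B(2), of "\<lambda>b. g (r b)"] by blast
  interpret F: Vector_Spaces.linear "tscale :: 'k \<Rightarrow> ('k, 'v) tensor \<Rightarrow> _" t F by fact
  have Fp: "F (pure_tensor s vs) = g vs" if len: "length vs = n" for vs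
  proof (rule ccontr)
    assume "F (pure_tensor s vs) \<noteq> g vs"
    then have "P.vs2.independent {F (pure_tensor s vs) - g vs}" by simp
    from Q.linear_independent_extend[OF this, of "\<lambda>_. 1"] obtain p
      where p: "Vector_Spaces.linear t (*) p" "p (F (pure_tensor s vs) - g vs) = 1" by auto
    interpret p: Vector_Spaces.linear t "(*)" p by fact
    define b where "b xs = (if length xs = n then p (g xs) else 0)" for xs
    have b: "multilinear_form s b"
      unfolding multilinear_form_def
    proof (intro allI)
      fix xs ys :: "'v list"
      show "Vector_Spaces.linear s (*) (\<lambda>v. b (xs @ v # ys))"
      proof (cases "length xs + length ys + 1 = n")
        case True
        interpret g: Vector_Spaces.linear s t "\<lambda>v. g (xs @ v # ys)" by (rule g[OF True])
        show ?thesis using True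
          by unfold_locales (auto simp: b_def g.add g.scale p.add p.scale algebra_simps)
      next
        case False
        then show ?thesis
          by unfold_locales (auto simp: b_def algebra_simps)
      qed
    qed
    have "p (F S) = S b" if "S \<in> T.span B" for S
      using that
    proof (induction rule: T.span_induct_alt)
      case base
      then show ?case by (metis F.zero p.zero zero_fun_apply)
    next
      case (step c x y)
      have "p (F x) = b (r x)" using step F r by (simp add: b_def)
      also have "\<dots> = pure_tensor s (r x) b" by (simp add: pure_tensor_def b)
      also have "pure_tensor s (r x) = x" using r(2) step by simp
      finally have "p (F x) = x b" .
      then have "p (F (tscale c x + y)) = (tscale c x + y) b"
        using step(2) unfolding F.add F.scale p.add p.scale by (simp add: tscale_def)
      then show ?case by metis
    qed
    then have "p (F (pure_tensor s vs)) = pure_tensor s vs b"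
      using B len by blast
    also have "\<dots> = p (g vs)" using b len by (simp add: pure_tensor_def b_def)
    finally show False using p(2) by (simp add: p.diff)
  qed
  let ?f = "restrict F (tensor_power s n)"
  have f: "?f \<in> lin_maps tscale t (tensor_power s n) UNIV"
    unfolding lin_maps_def tensor_power_def
    by (auto simp: F.add F.scale T.span_add T.span_scale)
  have fp: "?f (pure_tensor s vs) = g vs" if "length vs = n" for vs
    using that Fp[OF that] by (auto simp: tensor_power_def T.span_base)
  show ?thesis
  proof (intro ex1I[of _ ?f] conjI allI impI f fp)
    fix h assume h: "h \<in> lin_maps tscale t (tensor_power s n) UNIV \<and>
      (\<forall>vs. length vs = n \<longrightarrow> h (pure_tensor s vs) = g vs)"
    show "h = ?f"
    proof (rule lin_maps_eq_on_span[OF vector_space_tscale \<open>vector_space t\<close>])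
      show "h \<in> lin_maps tscale t (T.span ?X) UNIV" "?f \<in> lin_maps tscale t (T.span ?X) UNIV"
        using h f by (simp_all add: tensor_power_def)
      show "h x = ?f x" if "x \<in> ?X" for x
        using that h fp by (metis (mono_tags, lifting) imageE mem_Collect_eq)
    qed
  qed
qed

lemma multilinear_form_append:
  assumes "multilinear_form s B"
  shows "multilinear_form s (\<lambda>ys. B (xs @ ys))" "multilinear_form s (\<lambda>ys. B (ys @ xs))"
proof -
  have "Vector_Spaces.linear s (*) (\<lambda>v. B ((xs @ us) @ v # ws))"
    "Vector_Spaces.linear s (*) (\<lambda>v. B (us @ v # (ws @ xs)))" for us ws
    using assms unfolding multilinear_form_def by blast+
  then show "multilinear_form s (\<lambda>ys. B (xs @ ys))" "multilinear_form s (\<lambda>ys. B (ys @ xs))"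
    unfolding multilinear_form_def by simp_all
qed

lemma multilinear_form_tensor:
  fixes s :: "'a::field \<Rightarrow> 'b::ab_group_add \<Rightarrow> 'b"
  assumes "vector_space s" "multilinear_form s B" "T \<in> tensor_power s n"
  shows "multilinear_form s (\<lambda>xs. T (\<lambda>ys. B (xs @ ys)))"
proof -
  interpret T: vector_space "tscale :: 'a \<Rightarrow> ('a, 'b) tensor \<Rightarrow> _" by (rule vector_space_tscale)
  interpret V: vector_space s by fact
  interpret P: vector_space_pair s "(*)"
    using assms by (simp add: vector_space_pair_def vector_space_mult)
  show ?thesis
    using assms(3) unfolding tensor_power_def
  proof (induction rule: T.span_induct_alt)
    case base
    show ?case unfolding multilinear_form_def by (intro allI, unfold_locales) auto
  next
    case (step c x y)
    then obtain vs where "x = pure_tensor s vs" by blast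
    then have "x (\<lambda>ys. B (xs @ ys)) = B (xs @ vs)" for xs
      using multilinear_form_append(1)[OF assms(2)] by (simp add: pure_tensor_def)
    moreover have "multilinear_form s (\<lambda>xs. B (xs @ vs))"
      by (rule multilinear_form_append(2)[OF assms(2)])
    moreover have "multilinear_form s (\<lambda>xs. c * A xs + D xs)"
      if "multilinear_form s A" "multilinear_form s D" for A D
      using that unfolding multilinear_form_def
      by (auto intro!: P.linear_compose_add P.linear_compose_scale_right)
    ultimately show ?case
      using step(2) by (simp only: tscale_def plus_fun_apply)
  qed
qed

lemma tensor_form_linear:
  fixes s :: "'a::field \<Rightarrow> 'b::ab_group_add \<Rightarrow> 'b"
  assumes "S \<in> tensor_power s n" "multilinear_form s A" "multilinear_form s B"
    "multilinear_form s (\<lambda>xs. A xs + B xs)" "multilinear_form s (\<lambda>xs. c * A xs)"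
  shows "S (\<lambda>xs. A xs + B xs) = S A + S B" "S (\<lambda>xs. c * A xs) = c * S A"
proof -
  interpret T: vector_space "tscale :: 'a \<Rightarrow> ('a, 'b) tensor \<Rightarrow> _" by (rule vector_space_tscale)
  have "S (\<lambda>xs. A xs + B xs) = S A + S B \<and> S (\<lambda>xs. c * A xs) = c * S A"
    using assms(1) unfolding tensor_power_def
  proof (induction rule: T.span_induct_alt)
    case base
    show ?case by simp
  next
    case (step d x y)
    then obtain vs where "x = pure_tensor s vs" by blast
    then show ?case using step assms(2-)
      by (auto simp: pure_tensor_def tscale_def algebra_simps)
  qed
  then show "S (\<lambda>xs. A xs + B xs) = S A + S B" "S (\<lambda>xs. c * A xs) = c * S A" by auto
qed

lemma tprod_pure:
  fixes s :: "'a::field \<Rightarrow> 'b::ab_group_add \<Rightarrow> 'b"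
  assumes "vector_space s"
  shows "tprod s (pure_tensor s us) (pure_tensor s vs) = pure_tensor s (us @ vs)"
proof -
  interpret T: vector_space "tscale :: 'a \<Rightarrow> ('a, 'b) tensor \<Rightarrow> _" by (rule vector_space_tscale)
  have "multilinear_form s (\<lambda>xs. pure_tensor s vs (\<lambda>ys. B (xs @ ys)))" if "multilinear_form s B" for B
    using multilinear_form_tensor[OF assms that, of "pure_tensor s vs" "length vs"]
    by (auto simp: tensor_power_def T.span_base)
  then show ?thesis
    using multilinear_form_append(1)[of s]
    by (auto simp: fun_eq_iff tprod_def pure_tensor_def)
qed

lemma tprod_linear_left:
  "tprod s (S + S') T = tprod s S T + tprod s S' T"
  "tprod s (tscale a S) T = tscale a (tprod s S T)"
  by (auto simp: tprod_def tscale_def fun_eq_iff)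

lemma tprod_linear_right:
  fixes s :: "'a::field \<Rightarrow> 'b::ab_group_add \<Rightarrow> 'b"
  assumes "vector_space s" "S \<in> tensor_power s m" "T \<in> tensor_power s n" "T' \<in> tensor_power s n"
  shows "tprod s S (T + T') = tprod s S T + tprod s S T'"
    and "tprod s S (tscale a T) = tscale a (tprod s S T)"
proof -
  interpret T: vector_space "tscale :: 'a \<Rightarrow> ('a, 'b) tensor \<Rightarrow> _" by (rule vector_space_tscale)
  have mem: "T + T' \<in> tensor_power s n" "tscale a T \<in> tensor_power s n"
    using assms by (auto simp: tensor_power_def T.span_add T.span_scale)
  note * = multilinear_form_tensor[OF assms(1)]
  have "tprod s S (T + T') B = (tprod s S T + tprod s S T') B \<and>
    tprod s S (tscale a T) B = tscale a (tprod s S T) B" for B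
  proof (cases "multilinear_form s B")
    case True
    then show ?thesis
      using tensor_form_linear[OF assms(2) *[OF True assms(3)] *[OF True assms(4)], of a]
        *[OF True mem(1)] *[OF True mem(2)]
      by (simp add: tprod_def tscale_def)
  qed (simp add: tprod_def tscale_def)
  then show "tprod s S (T + T') = tprod s S T + tprod s S T'"
    "tprod s S (tscale a T) = tscale a (tprod s S T)"
    by (auto simp: fun_eq_iff)
qed

lemma subspace_tensor_power:
  fixes s :: "'a::field \<Rightarrow> 'b::ab_group_add \<Rightarrow> 'b"
  shows "module.subspace tscale (tensor_power s n)"
proof -
  interpret T: vector_space "tscale :: 'a \<Rightarrow> ('a, 'b) tensor \<Rightarrow> _" by (rule vector_space_tscale)
  show ?thesis unfolding tensor_power_def by (rule T.subspace_span)
qed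

lemma tprod_mem:
  fixes s :: "'a::field \<Rightarrow> 'b::ab_group_add \<Rightarrow> 'b"
  assumes "vector_space s" "S \<in> tensor_power s m" "T \<in> tensor_power s n"
  shows "tprod s S T \<in> tensor_power s (m + n)"
proof -
  interpret T: vector_space "tscale :: 'a \<Rightarrow> ('a, 'b) tensor \<Rightarrow> _" by (rule vector_space_tscale)
  have p: "tprod s (pure_tensor s us) T \<in> tensor_power s (m + n)" if "length us = m" for us
  proof -
    have us: "pure_tensor s us \<in> tensor_power s m"
      using that by (auto simp: tensor_power_def intro: T.span_base)
    have "T \<in> tensor_power s n \<and> tprod s (pure_tensor s us) T \<in> tensor_power s (m + n)"
      using assms(3) unfolding tensor_power_def[of s n]
    proof (induction rule: T.span_induct_alt)
      case base
      have "tprod s (pure_tensor s us) 0 = 0"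
        using tprod_linear_right(2)[OF assms(1) us T.subspace_0[OF subspace_tensor_power]
            T.subspace_0[OF subspace_tensor_power], of 0] by simp
      then show ?case unfolding tensor_power_def using T.span_zero by metis
    next
      case (step c x y)
      then obtain vs where x: "x = pure_tensor s vs" "length vs = n" by blast
      then have 1: "x \<in> tensor_power s n" by (auto simp: tensor_power_def intro: T.span_base)
      then have 2: "tscale c x \<in> tensor_power s n"
        using T.subspace_scale[OF subspace_tensor_power] by blast
      have "tprod s (pure_tensor s us) (tscale c x + y) =
        tscale c (pure_tensor s (us @ vs)) + tprod s (pure_tensor s us) y"
        using tprod_linear_right(1)[OF assms(1) us 2] tprod_linear_right(2)[OF assms(1) us 1 1]
          step x by (simp add: tensor_power_def tprod_pure[OF assms(1)])
      moreover have "pure_tensor s (us @ vs) \<in> tensor_power s (m + n)"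
        using x that by (auto simp: tensor_power_def intro: T.span_base)
      ultimately have "tprod s (pure_tensor s us) (tscale c x + y) \<in> tensor_power s (m + n)"
        using step by (auto simp: tensor_power_def T.span_add T.span_scale)
      moreover have "tscale c x + y \<in> T.span (pure_tensor s ` {vs. length vs = n})"
        using step 2 by (auto simp only: tensor_power_def T.span_add)
      ultimately show ?case by metis
    qed
    then show ?thesis by blast
  qed
  show ?thesis
    using assms(2) unfolding tensor_power_def[of s m]
  proof (induction rule: T.span_induct_alt)
    case base
    have "tprod s 0 T = 0" by (auto simp: tprod_def)
    then show ?case unfolding tensor_power_def using T.span_zero by metis
  next
    case (step c x y)
    then have "tprod s (tscale c x + y) T \<in> tensor_power s (m + n)"
      using p unfolding tprod_linear_left
      by (auto simp: tensor_power_def intro!: T.span_add T.span_scale)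
    then show ?case by (metis tensor_power_def)
  qed
qed

lemma tensor_sub_tensor_power:
  fixes s :: "'a::field \<Rightarrow> 'b::ab_group_add \<Rightarrow> 'b"
  assumes "vector_space s"
  shows "tensor_sub s (tensor_power s m) (tensor_power s n) = tensor_power s (m + n)"
proof -
  interpret T: vector_space "tscale :: 'a \<Rightarrow> ('a, 'b) tensor \<Rightarrow> _" by (rule vector_space_tscale)
  let ?Y = "{tprod s S T | S T. S \<in> tensor_power s m \<and> T \<in> tensor_power s n}"
  have p: "pure_tensor s us \<in> tensor_power s k" if "length us = k" for us k
    using that by (auto simp: tensor_power_def intro: T.span_base)
  have "pure_tensor s us \<in> ?Y" if "length us = m + n" for us
    using that p[of "take m us" m] p[of "drop m us" n]
      tprod_pure[OF assms, of "take m us" "drop m us"] by force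
  then have "T.span (pure_tensor s ` {us. length us = m + n}) \<subseteq> T.span ?Y"
    by (intro T.span_mono) blast
  moreover have "T.span ?Y \<subseteq> tensor_power s (m + n)"
    using tprod_mem[OF assms] by (intro T.span_minimal subspace_tensor_power) blast
  ultimately show ?thesis
    unfolding tensor_sub_def by (simp add: tensor_power_def subset_antisym)
qed

lemma linear_pure_tensor:
  fixes s :: "'a::field \<Rightarrow> 'b::ab_group_add \<Rightarrow> 'b"
  assumes "vector_space s"
  shows "Vector_Spaces.linear s tscale (\<lambda>v. pure_tensor s (xs @ v # ys))"
proof -
  interpret V: vector_space s by fact
  interpret T: vector_space "tscale :: 'a \<Rightarrow> ('a, 'b) tensor \<Rightarrow> _" by (rule vector_space_tscale)
  have l: "Vector_Spaces.linear s (*) (\<lambda>v. B (xs @ v # ys))" if "multilinear_form s B" for B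
    using that by (simp add: multilinear_form_def)
  show ?thesis
    using module_hom.add[OF Vector_Spaces.linear.axioms(3)[OF l]]
      module_hom.scale[OF Vector_Spaces.linear.axioms(3)[OF l]]
    by unfold_locales (auto simp: pure_tensor_def tscale_def fun_eq_iff)
qed

lemma tensor_map_ex1:
  fixes s :: "'k::field \<Rightarrow> 'v::ab_group_add \<Rightarrow> 'v"
  assumes "vector_space s"
    and A: "module.subspace tscale A" "A \<subseteq> tensor_power s m"
    and C: "module.subspace tscale C" "C \<subseteq> tensor_power s n"
    and f: "restrict f A \<in> lin_maps tscale tscale A (tensor_power s p)"
    and g: "restrict g C \<in> lin_maps tscale tscale C (tensor_power s q)"
  shows "\<exists>!h. h \<in> lin_maps tscale tscale (tensor_sub s A C) UNIV \<and>
    (\<forall>S\<in>A. \<forall>T\<in>C. h (tprod s S T) = tprod s (f S) (g T))"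
proof -
  let ?t = "tscale :: 'k \<Rightarrow> ('k, 'v) tensor \<Rightarrow> _"
  interpret T: vector_space ?t by (rule vector_space_tscale)
  interpret TT: vector_space_pair ?t ?t by unfold_locales
  interpret V: vector_space s by fact
  obtain F where F: "Vector_Spaces.linear ?t ?t F" "\<And>x. x \<in> A \<Longrightarrow> F x = f x" "\<And>x. F x \<in> tensor_power s p"
    using lin_maps_extend[OF vector_space_tscale vector_space_tscale A(1) subspace_tensor_power f] by (auto simp: subset_eq)
  obtain G where G: "Vector_Spaces.linear ?t ?t G" "\<And>x. x \<in> C \<Longrightarrow> G x = g x" "\<And>x. G x \<in> tensor_power s q"
    using lin_maps_extend[OF vector_space_tscale vector_space_tscale C(1) subspace_tensor_power g] by (auto simp: subset_eq)
  interpret F: Vector_Spaces.linear ?t ?t F by fact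
  interpret G: Vector_Spaces.linear ?t ?t G by fact
  define b where "b vs = tprod s (F (pure_tensor s (take m vs))) (G (pure_tensor s (drop m vs)))" for vs
  have b: "Vector_Spaces.linear s ?t (\<lambda>v. b (xs @ v # ys))" if len: "length xs + length ys + 1 = m + n" for xs ys
  proof (cases "length xs < m")
    case True
    then obtain d where d: "m - length xs = Suc d" by (metis Suc_diff_Suc)
    interpret l: Vector_Spaces.linear s ?t "\<lambda>v. pure_tensor s (xs @ v # take d ys)"
      by (rule linear_pure_tensor) fact
    show ?thesis using True d
      by unfold_locales (auto simp: b_def l.add l.scale F.add F.scale tprod_linear_left)
  next
    case False
    interpret l: Vector_Spaces.linear s ?t "\<lambda>v. pure_tensor s (drop m xs @ v # ys)"
      by (rule linear_pure_tensor) fact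
    show ?thesis using False
      by unfold_locales (auto simp: b_def l.add l.scale G.add G.scale
          tprod_linear_right[OF assms(1) F(3) G(3) G(3)])
  qed
  obtain h where h: "h \<in> lin_maps ?t ?t (tensor_power s (m + n)) UNIV"
    "\<And>vs. length vs = m + n \<Longrightarrow> h (pure_tensor s vs) = b vs"
    using tensor_power_universal[OF assms(1) vector_space_tscale, of "m + n" b] b by blast
  obtain H where H: "Vector_Spaces.linear ?t ?t H" "\<And>x. x \<in> tensor_power s (m + n) \<Longrightarrow> H x = h x"
    using lin_maps_extend[OF vector_space_tscale vector_space_tscale subspace_tensor_power _ h(1)]
      T.subspace_UNIV by blast
  interpret H: Vector_Spaces.linear ?t ?t H by fact
  have Hp: "H (pure_tensor s vs) = b vs" if "length vs = m + n" for vs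
    using that h H by (auto simp: tensor_power_def T.span_base)
  have H1: "H (tprod s (pure_tensor s us) T) = tprod s (F (pure_tensor s us)) (G T)"
    if us: "length us = m" and T: "T \<in> tensor_power s n" for us T
  proof -
    have u: "pure_tensor s us \<in> tensor_power s m"
      using us by (auto simp: tensor_power_def intro: T.span_base)
    have z: "0 \<in> tensor_power s k" for k by (auto simp: tensor_power_def T.span_zero)
    have "T \<in> tensor_power s n \<and> H (tprod s (pure_tensor s us) T) = tprod s (F (pure_tensor s us)) (G T)"
      using T unfolding tensor_power_def[of s n]
    proof (induction rule: T.span_induct_alt)
      case base
      have "tprod s (pure_tensor s us) 0 = 0" "tprod s (F (pure_tensor s us)) 0 = 0"
        using tprod_linear_right(2)[OF assms(1) u z z, of 0]
          tprod_linear_right(2)[OF assms(1) F(3) z z, where a = 0] by auto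
      then have "H (tprod s (pure_tensor s us) 0) = tprod s (F (pure_tensor s us)) (G 0)"
        by (simp only: H.zero G.zero)
      then show ?case using z[of n] unfolding tensor_power_def by metis
    next
      case (step c x y)
      then obtain vs where x: "x = pure_tensor s vs" "length vs = n" by blast
      then have 1: "x \<in> tensor_power s n" by (auto simp: tensor_power_def intro: T.span_base)
      then have 2: "tscale c x \<in> tensor_power s n"
        using T.subspace_scale[OF subspace_tensor_power] by blast
      have y: "y \<in> tensor_power s n" using step by (simp add: tensor_power_def)
      have "H (tprod s (pure_tensor s us) x) = tprod s (F (pure_tensor s us)) (G x)"
        using x us by (simp add: tprod_pure[OF assms(1)] Hp b_def)
      then have "H (tprod s (pure_tensor s us) (tscale c x + y)) =
          tprod s (F (pure_tensor s us)) (G (tscale c x + y))"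
        using step tprod_linear_right(1)[OF assms(1) u 2 y] tprod_linear_right(2)[OF assms(1) u 1 1]
          tprod_linear_right(1)[OF assms(1) F(3) T.subspace_scale[OF subspace_tensor_power G(3)] G(3)]
          tprod_linear_right(2)[OF assms(1) F(3) G(3) G(3)]
        by (simp add: H.add H.scale G.add G.scale)
      moreover have "tscale c x + y \<in> tensor_power s n"
        using 2 y T.subspace_add[OF subspace_tensor_power] by blast
      ultimately show ?case by (metis tensor_power_def)
    qed
    then show ?thesis by blast
  qed
  have H2: "H (tprod s S T) = tprod s (F S) (G T)"
    if S: "S \<in> tensor_power s m" and T: "T \<in> tensor_power s n" for S T
    using S unfolding tensor_power_def[of s m]
  proof (induction rule: T.span_induct_alt)
    case base
    have "tprod s 0 X = 0" for X by (auto simp: tprod_def)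
    then show ?case by (metis H.zero F.zero)
  next
    case (step c x y)
    then obtain us where "x = pure_tensor s us" "length us = m" by blast
    then have "H (tprod s (tscale c x + y) T) = tprod s (F (tscale c x + y)) (G T)"
      using step H1[OF _ T] unfolding tprod_linear_left H.add H.scale F.add F.scale by simp
    then show ?case by metis
  qed
  let ?h = "restrict H (tensor_sub s A C)"
  have hl: "?h \<in> lin_maps ?t ?t (tensor_sub s A C) UNIV"
    unfolding lin_maps_def tensor_sub_def
    by (auto simp: H.add H.scale T.span_add T.span_scale)
  have hp: "?h (tprod s S T) = tprod s (f S) (g T)" if "S \<in> A" "T \<in> C" for S T
  proof -
    have "tprod s S T \<in> tensor_sub s A C"
      unfolding tensor_sub_def using that by (intro T.span_base) auto
    moreover have "S \<in> tensor_power s m" "T \<in> tensor_power s n" using that A(2) C(2) by blast+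
    ultimately show ?thesis using that by (simp add: H2 F(2) G(2))
  qed
  show ?thesis
  proof (intro ex1I[of _ ?h] conjI ballI hl hp)
    fix h' assume h': "h' \<in> lin_maps ?t ?t (tensor_sub s A C) UNIV \<and>
      (\<forall>S\<in>A. \<forall>T\<in>C. h' (tprod s S T) = tprod s (f S) (g T))"
    show "h' = ?h"
    proof (rule lin_maps_eq_on_span[OF vector_space_tscale vector_space_tscale])
      let ?Y = "{tprod s S T | S T. S \<in> A \<and> T \<in> C}"
      show "h' \<in> lin_maps ?t ?t (T.span ?Y) UNIV" "?h \<in> lin_maps ?t ?t (T.span ?Y) UNIV"
        using h' hl by (simp_all add: tensor_sub_def)
      show "h' x = ?h x" if "x \<in> ?Y" for x
        using that h' hp by (smt (verit) mem_Collect_eq)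
    qed
  qed
qed

section \<open>Braided vector spaces and QLie algebras\<close>

text \<open>
  \<open>f\<^sub>1 = f \<otimes> Id\<^sub>V\<close> and \<open>f\<^sub>2 = Id\<^sub>V \<otimes> f\<close> for \<open>f\<close> defined on a subspace \<open>D\<close> of \<open>V \<otimes> V\<close> with
  values in a tensor power of \<open>V\<close>. For \<open>\<beta>\<close> with values in \<open>V\<close>, take \<open>f = vec s \<circ> \<beta>\<close>.
\<close>

definition fst_leg where
  "fst_leg s D f = tensor_map s D (tensor_power s 1) f id"

definition snd_leg where
  "snd_leg s D f = tensor_map s (tensor_power s 1) D id f"

definition braided_vector_space ::
  "('k::field \<Rightarrow> 'v::ab_group_add \<Rightarrow> 'v) \<Rightarrow> (('k, 'v) tensor \<Rightarrow> ('k, 'v) tensor) \<Rightarrow> bool"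
  where "braided_vector_space s c \<longleftrightarrow>
    vector_space s \<and>
    c \<in> lin_maps tscale tscale (tensor_power s 2) (tensor_power s 2) \<and>
    (let c1 = fst_leg s (tensor_power s 2) c; c2 = snd_leg s (tensor_power s 2) c in
     \<forall>z \<in> tensor_power s 3. c1 (c2 (c1 z)) = c2 (c1 (c2 z)))"

definition E2 :: "('k::field \<Rightarrow> 'v::ab_group_add \<Rightarrow> 'v) \<Rightarrow> (('k, 'v) tensor \<Rightarrow> ('k, 'v) tensor) \<Rightarrow> ('k, 'v) tensor set"
  where "E2 s c = {x \<in> tensor_power s 2. c x + x = 0}"

definition E2_V where "E2_V s c = tensor_sub s (E2 s c) (tensor_power s 1)"

definition V_E2 where "V_E2 s c = tensor_sub s (tensor_power s 1) (E2 s c)"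

definition E2_bar where "E2_bar s c = E2_V s c \<inter> V_E2 s c"

definition c_E2_V where
  "c_E2_V s c = restrict (fst_leg s (tensor_power s 2) c \<circ> snd_leg s (tensor_power s 2) c) (E2_V s c)"

definition c_V_E2 where
  "c_V_E2 s c = restrict (snd_leg s (tensor_power s 2) c \<circ> fst_leg s (tensor_power s 2) c) (V_E2 s c)"

definition qlie_algebra ::
  "('k::field \<Rightarrow> 'v::ab_group_add \<Rightarrow> 'v) \<Rightarrow> (('k, 'v) tensor \<Rightarrow> ('k, 'v) tensor) \<Rightarrow> (('k, 'v) tensor \<Rightarrow> 'v) \<Rightarrow> bool"
  where "qlie_algebra s c \<beta> \<longleftrightarrow>
    braided_vector_space s c \<and>
    \<beta> \<in> lin_maps tscale s (E2 s c) UNIV \<and>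
    (let \<beta>1 = fst_leg s (E2 s c) (vec s \<circ> \<beta>);
         \<beta>2 = snd_leg s (E2 s c) (vec s \<circ> \<beta>) in
     (\<forall>z \<in> E2_V s c. c (\<beta>1 z) = \<beta>2 (c_E2_V s c z)) \<and>
     (\<forall>z \<in> V_E2 s c. c (\<beta>2 z) = \<beta>1 (c_V_E2 s c z)) \<and>
     (\<forall>z \<in> E2_bar s c. \<beta> (\<beta>1 z - \<beta>2 z) = 0))"

definition lifted_qlie_algebra ::
  "('k::field \<Rightarrow> 'v::ab_group_add \<Rightarrow> 'v) \<Rightarrow> (('k, 'v) tensor \<Rightarrow> ('k, 'v) tensor) \<Rightarrow> (('k, 'v) tensor \<Rightarrow> 'v) \<Rightarrow> bool"
  where "lifted_qlie_algebra s c \<beta> \<longleftrightarrow>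
    braided_vector_space s c \<and>
    \<beta> \<in> lin_maps tscale s (tensor_power s 2) UNIV \<and>
    (let c1 = fst_leg s (tensor_power s 2) c;
         c2 = snd_leg s (tensor_power s 2) c;
         \<beta>1 = fst_leg s (tensor_power s 2) (vec s \<circ> \<beta>);
         \<beta>2 = snd_leg s (tensor_power s 2) (vec s \<circ> \<beta>) in
     (\<forall>z \<in> tensor_power s 3. c (\<beta>1 z) = \<beta>2 (c1 (c2 z))) \<and>
     (\<forall>z \<in> tensor_power s 3. c (\<beta>2 z) = \<beta>1 (c2 (c1 z))) \<and>
     (\<forall>z \<in> E2_bar s c. \<beta> (\<beta>1 z - \<beta>2 z) = 0) \<and>
     (\<forall>x \<in> tensor_power s 2. \<beta> (c x) = - \<beta> x))"

text \<open>The endomorphism \<open>f(c)\<close> of \<open>V \<otimes> V\<close>, evaluated at \<open>x\<close>.\<close>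

definition poly_end ::
  "'k::field poly \<Rightarrow> (('k, 'v) tensor \<Rightarrow> ('k, 'v) tensor) \<Rightarrow> ('k, 'v) tensor \<Rightarrow> ('k, 'v) tensor"
  where "poly_end f c x = (\<Sum>i\<le>degree f. tscale (coeff f i) ((c ^^ i) x))"

end

theory Submission
  imports Defs
begin

text \<open>
  Since \<open>(c + Id) h(c) = 0\<close>, \<open>h(c)\<close> maps \<open>V \<otimes> V\<close> into \<open>E\<^sub>2\<close>, where it acts as the nonzero scalar
  \<open>h(-1)\<close>; and \<open>\<beta> c = -\<beta>\<close> gives \<open>\<beta> h(c) = h(-1) \<beta>\<close>. So \<open>\<beta> \<mapsto> h(-1)\<^sup>-\<^sup>1 \<beta>|E\<^sub>2\<close> is the inverse map.
  The braid equation gives \<open>c\<^sub>1c\<^sub>2 h(c\<^sub>1) = h(c\<^sub>2) c\<^sub>1c\<^sub>2\<close> and \<open>c\<^sub>2c\<^sub>1 h(c\<^sub>2) = h(c\<^sub>1) c\<^sub>2c\<^sub>1\<close>, which carries the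
  compatibility conditions between \<open>E\<^sub>2 \<otimes> V\<close>, \<open>V \<otimes> E\<^sub>2\<close> and \<open>V\<^sup>\<otimes>\<^sup>3\<close>.
\<close>

interpretation T: vector_space "tscale :: 'k::field \<Rightarrow> ('k, 'v) tensor \<Rightarrow> _"
  by (rule vector_space_tscale)

section \<open>Linear maps between subspaces of tensors\<close>

lemma subspace_scale_cancel: "T.subspace A \<Longrightarrow> a \<noteq> 0 \<Longrightarrow> tscale a z \<in> A \<Longrightarrow> z \<in> A"
  using T.subspace_scale[of A "tscale a z" "inverse a"] by simp

text \<open>Unlike \<open>lin_maps\<close>, this does not ask for extensionality, so one function
  can be linear on several nested subspaces and compositions need no \<open>restrict\<close>. The
  codomain \<open>W\<close> is tracked because later steps need images inside
  \<open>E2\<close>.\<close>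

definition lin_on ::
  "('k::field, 'v) tensor set \<Rightarrow> ('k, 'v) tensor set \<Rightarrow> (('k, 'v) tensor \<Rightarrow> ('k, 'v) tensor) \<Rightarrow> bool"
  where "lin_on A W g \<longleftrightarrow> (\<forall>x\<in>A. g x \<in> W) \<and> (\<forall>x\<in>A. \<forall>y\<in>A. g (x + y) = g x + g y) \<and>
    (\<forall>a. \<forall>x\<in>A. g (tscale a x) = tscale a (g x))"

lemma lin_onD:
  assumes "lin_on A W g" "x \<in> A"
  shows "g x \<in> W" "y \<in> A \<Longrightarrow> g (x + y) = g x + g y" "g (tscale a x) = tscale a (g x)"
  using assms by (auto simp: lin_on_def)

lemma lin_on_zero: "lin_on A W g \<Longrightarrow> 0 \<in> A \<Longrightarrow> g 0 = 0"
  using lin_onD(3)[of A W g 0 0] by simp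

lemma lin_on_uminus: "lin_on A W g \<Longrightarrow> x \<in> A \<Longrightarrow> g (- x) = - g x"
  using lin_onD(3)[of A W g x "- 1"] by simp

lemma lin_on_sum:
  assumes "lin_on A W g" "T.subspace A" "\<And>i. i \<in> I \<Longrightarrow> x i \<in> A"
  shows "g (\<Sum>i\<in>I. tscale (a i) (x i)) = (\<Sum>i\<in>I. tscale (a i) (g (x i)))"
  using assms(3)
proof (induction I rule: infinite_finite_induct)
  case (insert j I)
  then have "(\<Sum>i\<in>I. tscale (a i) (x i)) \<in> A" "x j \<in> A"
    by (auto intro!: T.subspace_sum[OF assms(2)] T.subspace_scale[OF assms(2)])
  moreover have "g (\<Sum>i\<in>I. tscale (a i) (x i)) = (\<Sum>i\<in>I. tscale (a i) (g (x i)))"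
    using insert by blast
  ultimately show ?case
    by (simp only: sum.insert[OF insert(1,2)] lin_onD[OF assms(1)] T.subspace_scale[OF assms(2)])
qed (use lin_on_zero[OF assms(1) T.subspace_0[OF assms(2)]] in auto)

lemma lin_on_mono: "lin_on A W g \<Longrightarrow> B \<subseteq> A \<Longrightarrow> W \<subseteq> U \<Longrightarrow> lin_on B U g"
  unfolding lin_on_def by blast

lemma lin_on_comp: "lin_on A B f \<Longrightarrow> lin_on B C g \<Longrightarrow> lin_on A C (g \<circ> f)"
  by (auto simp: lin_on_def)

lemma lin_on_id: "lin_on A A id"
  by (simp add: lin_on_def)

lemma lin_on_scale: "lin_on A W g \<Longrightarrow> T.subspace W \<Longrightarrow> lin_on A W (\<lambda>x. tscale a (g x))"
  by (auto simp: lin_on_def T.subspace_scale T.scale_right_distrib mult.commute)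

lemma lin_on_funpow: "lin_on A A g \<Longrightarrow> lin_on A A (g ^^ n)"
  by (induction n) (auto simp: lin_on_id intro: lin_on_comp)

lemma lin_maps_lin_on: "g \<in> lin_maps tscale tscale A W \<Longrightarrow> lin_on A W g"
  by (auto simp: lin_maps_def lin_on_def)

lemma lin_on_lin_maps:
  "lin_on A W g \<Longrightarrow> T.subspace A \<Longrightarrow> restrict g A \<in> lin_maps tscale tscale A W"
  by (auto simp: lin_maps_def lin_on_def T.subspace_add T.subspace_scale)

lemma lin_on_span_eq:
  assumes "lin_on (T.span X) U f" "lin_on (T.span X) W g" "\<And>x. x \<in> X \<Longrightarrow> f x = g x"
    and "z \<in> T.span X"
  shows "f z = g z"
proof -
  have "restrict f (T.span X) = restrict g (T.span X)"
  proof (rule lin_maps_eq_on_span[OF vector_space_tscale vector_space_tscale])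
    show "restrict f (T.span X) \<in> lin_maps tscale tscale (T.span X) UNIV"
      "restrict g (T.span X) \<in> lin_maps tscale tscale (T.span X) UNIV"
      using assms by (auto intro!: lin_on_lin_maps intro: lin_on_mono)
  qed (simp add: T.span_base assms(3))
  then show ?thesis using assms(4) by (metis restrict_apply')
qed

text \<open>By linearity a codomain can be sharpened by checking generators alone; this puts images
  of tensor products of maps into a \<open>tensor_sub\<close>.\<close>

lemma lin_on_span_image:
  assumes "lin_on (T.span X) U f" "T.subspace W" "\<And>x. x \<in> X \<Longrightarrow> f x \<in> W"
  shows "lin_on (T.span X) W f"
proof -
  have "z \<in> T.span X \<and> f z \<in> W" if "z \<in> T.span X" for z
    using that
  proof (induction rule: T.span_induct_alt)
    case base
    then show ?case
      using lin_on_zero[OF assms(1)] T.span_zero T.subspace_0[OF assms(2)] by metis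
  next
    case (step a x y)
    then have "tscale a x \<in> T.span X" "x \<in> T.span X" "f x \<in> W"
      by (auto intro: T.span_scale T.span_base assms(3))
    with step show ?case
      by (simp only: lin_onD[OF assms(1)]) (meson T.span_add T.subspace_add T.subspace_scale assms(2))
  qed
  then show ?thesis using assms(1) by (simp add: lin_on_def)
qed

section \<open>Polynomials in an endomorphism\<close>

text \<open>Coefficients beyond the degree vanish, so polynomials of different degrees can be summed
  over one common range.\<close>

lemma poly_end_bound:
  assumes "degree p \<le> n"
  shows "poly_end p g x = (\<Sum>i\<le>n. tscale (coeff p i) ((g ^^ i) x))"
  unfolding poly_end_def using assms
  by (intro sum.mono_neutral_left) (auto simp: coeff_eq_0)

lemma poly_end_X_plus_1:
  assumes "lin_on A A g" "T.subspace A" "x \<in> A"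
  shows "poly_end ([:1, 1:] * p) g x = poly_end p g x + g (poly_end p g x)"
proof -
  let ?n = "degree p"
  have "degree ([:1, 1:] * p) \<le> Suc ?n"
    using degree_mult_le[of "[:1, 1:]" p] by simp
  moreover have "[:1, 1:] * p = p + pCons 0 p" by simp
  ultimately have "poly_end ([:1, 1:] * p) g x =
      (\<Sum>i\<le>Suc ?n. tscale (coeff p i) ((g ^^ i) x)) +
      (\<Sum>i\<le>Suc ?n. tscale (coeff (pCons 0 p) i) ((g ^^ i) x))"
    by (simp only: poly_end_bound coeff_add T.scale_left_distrib sum.distrib)
  also have "(\<Sum>i\<le>Suc ?n. tscale (coeff p i) ((g ^^ i) x)) = poly_end p g x"
    by (simp only: poly_end_bound[of p "Suc ?n"])
  \<comment> \<open>Multiplying by X shifts coefficients: the term for 0 vanishes, and term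
    \<open>Suc i\<close> is \<open>g\<close> applied to term \<open>i\<close> of
    \<open>p\<close>.\<close>
  also have "(\<Sum>i\<le>Suc ?n. tscale (coeff (pCons 0 p) i) ((g ^^ i) x)) =
      (\<Sum>i\<le>?n. tscale (coeff p i) (g ((g ^^ i) x)))"
    by (subst sum.atMost_Suc_shift) simp
  also have "\<dots> = g (poly_end p g x)"
    unfolding poly_end_def
    by (rule lin_on_sum[OF assms(1,2), symmetric]) (rule lin_onD(1)[OF lin_on_funpow[OF assms(1)] assms(3)])
  finally show ?thesis .
qed

lemma poly_end_eigen:
  assumes "lin_on A A g" "x \<in> A" "g x = tscale a x"
  shows "poly_end p g x = tscale (poly p a) x"
proof -
  have "(g ^^ i) x = tscale (a ^ i) x" for i
    by (induction i) (auto simp: lin_onD[OF assms(1,2)] assms(3) mult.commute)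
  then show ?thesis
    by (simp add: poly_end_def poly_altdef T.scale_sum_left)
qed

lemma lin_on_poly_end:
  assumes "lin_on A A g" "T.subspace A"
  shows "lin_on A A (poly_end p g)"
proof -
  note f = lin_onD[OF lin_on_funpow[OF assms(1)]]
  show ?thesis
    unfolding lin_on_def poly_end_def
    by (auto simp: f T.scale_right_distrib sum.distrib T.scale_sum_right mult.commute
        intro!: T.subspace_sum[OF assms(2)] T.subspace_scale[OF assms(2)])
qed

text \<open>The relation \<open>k g = g' k\<close> passes to powers by induction and to polynomials
  by linearity of \<open>k\<close>. It is applied with \<open>k\<close> a tensor product by a fixed
  vector, with \<open>k\<close> one of \<open>c1 \<circ> c2\<close> and
  \<open>c2 \<circ> c1\<close>, and with \<open>k = c\<close>.\<close>

lemma poly_end_intertwine: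
  assumes "lin_on A B k" "lin_on A A g" "T.subspace A" "\<And>y. y \<in> A \<Longrightarrow> k (g y) = g' (k y)"
    and x: "x \<in> A"
  shows "k (poly_end p g x) = poly_end p g' (k x)"
proof -
  have m: "(g ^^ i) x \<in> A" for i
    by (rule lin_onD(1)[OF lin_on_funpow[OF assms(2)] x])
  have "k ((g ^^ i) x) = (g' ^^ i) (k x)" for i
    by (induction i) (auto simp: assms(4) m)
  then show ?thesis
    unfolding poly_end_def using lin_on_sum[OF assms(1,3) m] by simp
qed

section \<open>Tensor products of linear maps\<close>

lemma subspace_tensor_sub: "T.subspace (tensor_sub s A C)"
  by (simp add: tensor_sub_def)

lemma tprod_in_tensor_sub: "S \<in> A \<Longrightarrow> T \<in> C \<Longrightarrow> tprod s S T \<in> tensor_sub s A C"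
  by (auto simp: tensor_sub_def intro!: T.span_base)

lemma tensor_sub_mono: "A \<subseteq> A' \<Longrightarrow> C \<subseteq> C' \<Longrightarrow> tensor_sub s A C \<subseteq> tensor_sub s A' C'"
  unfolding tensor_sub_def by (intro T.span_mono) blast

text \<open>The setting in which the definite description behind \<open>tensor_map\<close> is
  meaningful. \<open>A'\<close> and \<open>C'\<close> may be smaller than the ambient tensor powers,
  so that the image of \<open>f \<otimes> g\<close> is located precisely.\<close>

locale tensor_maps =
  fixes s :: "'k::field \<Rightarrow> 'v::ab_group_add \<Rightarrow> 'v"
    and A C :: "('k, 'v) tensor set" and f g :: "('k, 'v) tensor \<Rightarrow> ('k, 'v) tensor"
    and A' C' :: "('k, 'v) tensor set" and m n p q :: nat
  assumes vs: "vector_space s"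
    and A: "T.subspace A" "A \<subseteq> tensor_power s m"
    and C: "T.subspace C" "C \<subseteq> tensor_power s n"
    and A': "A' \<subseteq> tensor_power s p" and C': "C' \<subseteq> tensor_power s q"
    and f: "lin_on A A' f" and g: "lin_on C C' g"
begin

lemma tensor_map_ex:
  "tensor_map s A C f g \<in> lin_maps tscale tscale (tensor_sub s A C) UNIV \<and>
    (\<forall>S\<in>A. \<forall>T\<in>C. tensor_map s A C f g (tprod s S T) = tprod s (f S) (g T))"
  unfolding tensor_map_def
  by (rule theI'[OF tensor_map_ex1[OF vs A C]])
    (use A C A' C' f g in \<open>blast intro: lin_on_lin_maps lin_on_mono\<close>)+

lemma tensor_map_tprod:
  "S \<in> A \<Longrightarrow> T \<in> C \<Longrightarrow> tensor_map s A C f g (tprod s S T) = tprod s (f S) (g T)"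
  using tensor_map_ex by blast

lemma lin_on_tensor_map: "lin_on (tensor_sub s A C) (tensor_sub s A' C') (tensor_map s A C f g)"
proof -
  have "lin_on (tensor_sub s A C) UNIV (tensor_map s A C f g)"
    using tensor_map_ex by (blast intro: lin_maps_lin_on)
  then show ?thesis
    unfolding tensor_sub_def[of s A C]
    by (rule lin_on_span_image[OF _ subspace_tensor_sub])
      (auto simp: tensor_map_tprod intro!: tprod_in_tensor_sub lin_onD(1)[OF f] lin_onD(1)[OF g])
qed

text \<open>The products \<open>tprod s S T\<close> span the domain, so a linear map is determined
  by its values there. All later identities between legs are checked this way.\<close>

lemma tensor_map_unique:
  assumes "lin_on (tensor_sub s A C) U k"
    and "\<And>S T. S \<in> A \<Longrightarrow> T \<in> C \<Longrightarrow> k (tprod s S T) = tprod s (f S) (g T)"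
    and "z \<in> tensor_sub s A C"
  shows "k z = tensor_map s A C f g z"
  using assms(1) lin_on_tensor_map _ assms(3) unfolding tensor_sub_def[of s A C]
  by (rule lin_on_span_eq) (auto simp: assms(2) tensor_map_tprod)

end

section \<open>The legs of a map on \<open>V \<otimes> V\<close>\<close>

abbreviation first :: "('k::field \<Rightarrow> 'v::ab_group_add \<Rightarrow> 'v) \<Rightarrow> ('k, 'v) tensor set \<Rightarrow> ('k, 'v) tensor set"
  where "first s D \<equiv> tensor_sub s D (tensor_power s 1)"

abbreviation second :: "('k::field \<Rightarrow> 'v::ab_group_add \<Rightarrow> 'v) \<Rightarrow> ('k, 'v) tensor set \<Rightarrow> ('k, 'v) tensor set"
  where "second s D \<equiv> tensor_sub s (tensor_power s 1) D"

text \<open>One setting for all maps whose legs occur: \<open>c\<close>, \<open>h(c)\<close>, the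
  identity of \<open>E2\<close>, and brackets \<open>vec s \<circ> \<beta>\<close> on
  \<open>E2\<close> or on the whole of \<open>V \<otimes> V\<close>.\<close>

locale leg =
  fixes s :: "'k::field \<Rightarrow> 'v::ab_group_add \<Rightarrow> 'v"
    and D W :: "('k, 'v) tensor set" and f :: "('k, 'v) tensor \<Rightarrow> ('k, 'v) tensor" and m p :: nat
  assumes vs: "vector_space s" and D: "T.subspace D" "D \<subseteq> tensor_power s m"
    and W: "T.subspace W" "W \<subseteq> tensor_power s p" and f: "lin_on D W f"
begin

sublocale one: tensor_maps s D "tensor_power s 1" f id W "tensor_power s 1" m 1 p 1
  by unfold_locales (use vs D W f in \<open>auto simp: lin_on_id subspace_tensor_power vector_space_def\<close>)

sublocale two: tensor_maps s "tensor_power s 1" D id f "tensor_power s 1" W 1 m 1 p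
  by unfold_locales (use vs D W f in \<open>auto simp: lin_on_id subspace_tensor_power vector_space_def\<close>)

lemma fst_leg_tprod: "S \<in> D \<Longrightarrow> T \<in> tensor_power s 1 \<Longrightarrow> fst_leg s D f (tprod s S T) = tprod s (f S) T"
  and snd_leg_tprod: "T \<in> tensor_power s 1 \<Longrightarrow> S \<in> D \<Longrightarrow> snd_leg s D f (tprod s T S) = tprod s T (f S)"
  unfolding fst_leg_def snd_leg_def
  using one.tensor_map_tprod[of S T] two.tensor_map_tprod[of T S] by auto

lemma lin_on_fst_leg: "lin_on (first s D) (first s W) (fst_leg s D f)"
  and lin_on_snd_leg: "lin_on (second s D) (second s W) (snd_leg s D f)"
  unfolding fst_leg_def snd_leg_def by (rule one.lin_on_tensor_map two.lin_on_tensor_map)+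

lemma fst_leg_unique:
  assumes "lin_on (first s D) U k"
    and "\<And>S T. S \<in> D \<Longrightarrow> T \<in> tensor_power s 1 \<Longrightarrow> k (tprod s S T) = tprod s (f S) T"
    and "z \<in> first s D"
  shows "k z = fst_leg s D f z"
  unfolding fst_leg_def by (rule one.tensor_map_unique[OF assms(1) _ assms(3)]) (simp add: assms(2))

lemma snd_leg_unique:
  assumes "lin_on (second s D) U k"
    and "\<And>S T. T \<in> tensor_power s 1 \<Longrightarrow> S \<in> D \<Longrightarrow> k (tprod s T S) = tprod s T (f S)"
    and "z \<in> second s D"
  shows "k z = snd_leg s D f z"
  unfolding snd_leg_def by (rule two.tensor_map_unique[OF assms(1) _ assms(3)]) (simp add: assms(2))

lemma leg_comp:
  assumes "leg s W W' g p q"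
  shows "z \<in> first s D \<Longrightarrow> fst_leg s W g (fst_leg s D f z) = fst_leg s D (g \<circ> f) z"
    and "z \<in> second s D \<Longrightarrow> snd_leg s W g (snd_leg s D f z) = snd_leg s D (g \<circ> f) z"
proof -
  interpret g: leg s W W' g p q by fact
  interpret gf: leg s D W' "g \<circ> f" m q
    by unfold_locales (use vs D W g.W f g.f in \<open>auto simp: vector_space_def intro: lin_on_comp\<close>)
  show "fst_leg s W g (fst_leg s D f z) = fst_leg s D (g \<circ> f) z" if "z \<in> first s D"
    using gf.fst_leg_unique[OF lin_on_comp[OF lin_on_fst_leg g.lin_on_fst_leg] _ that]
    by (simp add: fst_leg_tprod g.fst_leg_tprod lin_onD(1)[OF f])
  show "snd_leg s W g (snd_leg s D f z) = snd_leg s D (g \<circ> f) z" if "z \<in> second s D"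
    using gf.snd_leg_unique[OF lin_on_comp[OF lin_on_snd_leg g.lin_on_snd_leg] _ that]
    by (simp add: snd_leg_tprod g.snd_leg_tprod lin_onD(1)[OF f])
qed

text \<open>Restricts the domain and extracts a scalar at once. The scalars used are -1 for
  \<open>c\<close> on \<open>E2\<close>, \<open>h(-1)\<close> for \<open>h(c)\<close> and for
  brackets on \<open>E2\<close>, and 1 for replacing a map by one that agrees with it on the
  domain.\<close>

lemma leg_scale_restrict:
  assumes "leg s D' W' g m q" "D \<subseteq> D'" "\<And>x. x \<in> D \<Longrightarrow> g x = tscale a (f x)"
  shows "z \<in> first s D \<Longrightarrow> fst_leg s D' g z = tscale a (fst_leg s D f z)"
    and "z \<in> second s D \<Longrightarrow> snd_leg s D' g z = tscale a (snd_leg s D f z)"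
proof -
  interpret g: leg s D' W' g m q by fact
  interpret af: leg s D W "\<lambda>x. tscale a (f x)" m p
    by unfold_locales (use vs D W f in \<open>auto simp: vector_space_def intro: lin_on_scale\<close>)
  \<comment> \<open>In its right factor \<open>tprod\<close> is known to be linear only on tensor
    powers, so the value \<open>f S\<close> has to be located in one.\<close>
  have t: "tprod s T (tscale a (f S)) = tscale a (tprod s T (f S))"
    if "T \<in> tensor_power s 1" "S \<in> D" for S T
    using tprod_linear_right(2)[OF vs that(1)] lin_onD(1)[OF f that(2)] W(2) by blast
  show "fst_leg s D' g z = tscale a (fst_leg s D f z)" if z: "z \<in> first s D"
  proof -
    have "lin_on (first s D) (first s W') (fst_leg s D' g)"
      using g.lin_on_fst_leg tensor_sub_mono[OF assms(2)] by (blast intro: lin_on_mono)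
    then have "fst_leg s D' g z = fst_leg s D (\<lambda>x. tscale a (f x)) z"
      by (rule af.fst_leg_unique[OF _ _ z]) (use assms in \<open>auto simp: g.fst_leg_tprod subset_eq\<close>)
    moreover have "tscale a (fst_leg s D f z) = fst_leg s D (\<lambda>x. tscale a (f x)) z"
      by (rule af.fst_leg_unique[OF lin_on_scale[OF lin_on_fst_leg subspace_tensor_sub] _ z])
        (simp add: fst_leg_tprod tprod_linear_left)
    ultimately show ?thesis by simp
  qed
  show "snd_leg s D' g z = tscale a (snd_leg s D f z)" if z: "z \<in> second s D"
  proof -
    have "lin_on (second s D) (second s W') (snd_leg s D' g)"
      using g.lin_on_snd_leg tensor_sub_mono[OF _ assms(2)] by (blast intro: lin_on_mono)
    then have "snd_leg s D' g z = snd_leg s D (\<lambda>x. tscale a (f x)) z"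
      by (rule af.snd_leg_unique[OF _ _ z]) (use assms in \<open>auto simp: g.snd_leg_tprod subset_eq\<close>)
    moreover have "tscale a (snd_leg s D f z) = snd_leg s D (\<lambda>x. tscale a (f x)) z"
      by (rule af.snd_leg_unique[OF lin_on_scale[OF lin_on_snd_leg subspace_tensor_sub] _ z])
        (simp add: snd_leg_tprod t)
    ultimately show ?thesis by simp
  qed
qed

end

text \<open>For fixed \<open>T\<close>, the maps \<open>tprod s _ T\<close> and
  \<open>tprod s T _\<close> intertwine \<open>g\<close> with its legs, hence also
  \<open>h(g)\<close> with \<open>h\<close> of the legs; uniqueness of the legs does the
  rest.\<close>

lemma leg_poly_end:
  assumes "leg s D D g m m"
  shows "z \<in> first s D \<Longrightarrow> fst_leg s D (poly_end h g) z = poly_end h (fst_leg s D g) z"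
    and "z \<in> second s D \<Longrightarrow> snd_leg s D (poly_end h g) z = poly_end h (snd_leg s D g) z"
proof -
  interpret g: leg s D D g m m by fact
  interpret p: leg s D D "poly_end h g" m m
    by unfold_locales
      (use g.vs g.D in \<open>auto simp: vector_space_def intro: lin_on_poly_end[OF g.f g.D(1)]\<close>)
  have l: "tprod s (poly_end h g S) T = poly_end h (fst_leg s D g) (tprod s S T)"
    if "S \<in> D" "T \<in> tensor_power s 1" for S T
  proof -
    have "lin_on D (first s D) (\<lambda>S. tprod s S T)"
      using that by (simp add: lin_on_def tprod_in_tensor_sub tprod_linear_left)
    then show ?thesis
      by (rule poly_end_intertwine[OF _ g.f g.D(1)]) (use that in \<open>auto simp: g.fst_leg_tprod\<close>)
  qed
  have r: "tprod s T (poly_end h g S) = poly_end h (snd_leg s D g) (tprod s T S)"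
    if "S \<in> D" "T \<in> tensor_power s 1" for S T
  proof -
    have "lin_on D (second s D) (\<lambda>S. tprod s T S)"
      using that g.D(2) tprod_linear_right[OF g.vs that(2), of _ m]
      by (auto simp: lin_on_def tprod_in_tensor_sub subset_eq)
    then show ?thesis
      by (rule poly_end_intertwine[OF _ g.f g.D(1)]) (use that in \<open>auto simp: g.snd_leg_tprod\<close>)
  qed
  show "fst_leg s D (poly_end h g) z = poly_end h (fst_leg s D g) z" if "z \<in> first s D"
    using p.fst_leg_unique[OF lin_on_poly_end[OF g.lin_on_fst_leg subspace_tensor_sub] _ that] l
    by simp
  show "snd_leg s D (poly_end h g) z = poly_end h (snd_leg s D g) z" if "z \<in> second s D"
    using p.snd_leg_unique[OF lin_on_poly_end[OF g.lin_on_snd_leg subspace_tensor_sub] _ that] r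
    by simp
qed

section \<open>The bijection\<close>

text \<open>Records what the factorisation of \<open>f\<close> provides:
  \<open>(c + Id) h(c) = 0\<close> on \<open>V \<otimes> V\<close> and
  \<open>h(-1) \<noteq> 0\<close>.\<close>

locale split_braiding =
  fixes s :: "'k::field \<Rightarrow> 'v::ab_group_add \<Rightarrow> 'v"
    and c :: "('k, 'v) tensor \<Rightarrow> ('k, 'v) tensor" and h :: "'k poly"
  assumes braided: "braided_vector_space s c"
    and c_poly_end: "x \<in> tensor_power s 2 \<Longrightarrow> c (poly_end h c x) = - poly_end h c x"
    and nonzero: "poly h (- 1) \<noteq> 0"
begin

abbreviation "V2 \<equiv> tensor_power s 2"
abbreviation "V3 \<equiv> tensor_power s 3"
abbreviation "E \<equiv> E2 s c"
abbreviation "P \<equiv> poly_end h c"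
abbreviation "c1 \<equiv> fst_leg s V2 c"
abbreviation "c2 \<equiv> snd_leg s V2 c"
abbreviation "P1 \<equiv> fst_leg s V2 P"
abbreviation "P2 \<equiv> snd_leg s V2 P"
abbreviation "\<kappa> \<equiv> poly h (- 1)"

lemma vs: "vector_space s"
  using braided by (simp add: braided_vector_space_def)

sublocale V: vector_space s by (rule vs)

lemma c_lin: "lin_on V2 V2 c"
  using braided by (auto simp: braided_vector_space_def intro: lin_maps_lin_on)

lemma braid: "z \<in> V3 \<Longrightarrow> c1 (c2 (c1 z)) = c2 (c1 (c2 z))"
  using braided by (simp add: braided_vector_space_def Let_def)

section \<open>The eigenspace \<open>E2\<close> and the action of \<open>h(c)\<close> on it\<close>

lemma E_sub: "E \<subseteq> V2"
  by (auto simp: E2_def)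

lemma E_c: "x \<in> E \<Longrightarrow> c x = - x"
  by (auto simp: E2_def eq_neg_iff_add_eq_0)

lemma E_I: "x \<in> V2 \<Longrightarrow> c x = - x \<Longrightarrow> x \<in> E"
  by (simp add: E2_def)

lemma E_subspace: "T.subspace E"
proof (rule T.subspaceI)
  note V2 = T.subspace_0[OF subspace_tensor_power] T.subspace_add[OF subspace_tensor_power]
    T.subspace_scale[OF subspace_tensor_power]
  show "0 \<in> E"
    by (rule E_I) (simp_all add: lin_on_zero[OF c_lin] V2)
  show "x + y \<in> E" if "x \<in> E" "y \<in> E" for x y
    using that E_sub by (intro E_I) (auto simp only: lin_onD[OF c_lin] E_c V2 minus_add_distrib add.commute subset_eq)
  show "tscale a x \<in> E" if "x \<in> E" for a x
    using that E_sub by (intro E_I) (auto simp only: lin_onD[OF c_lin] E_c V2 T.scale_minus_right subset_eq)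
qed

lemma P_lin: "lin_on V2 E P"
  using lin_on_poly_end[OF c_lin subspace_tensor_power, of h]
  by (auto simp: lin_on_def intro: E_I c_poly_end)

lemma P_E: "x \<in> E \<Longrightarrow> P x = tscale \<kappa> x"
  using E_sub E_c by (intro poly_end_eigen[OF c_lin]) auto

section \<open>The legs of \<open>c\<close> and \<open>h(c)\<close> on the third tensor
  power\<close>

sublocale c: leg s V2 V2 c 2 2
  by unfold_locales (use c_lin in \<open>auto simp: subspace_tensor_power\<close>)

sublocale P: leg s V2 E P 2 2
  by unfold_locales (use P_lin E_subspace E_sub in \<open>auto simp: subspace_tensor_power\<close>)

sublocale i: leg s E E id 2 2
  by unfold_locales (use E_subspace E_sub in \<open>auto simp: lin_on_id\<close>)

lemma V3: "first s V2 = V3" "second s V2 = V3"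
  using tensor_sub_tensor_power[OF vs, of 2 1] tensor_sub_tensor_power[OF vs, of 1 2]
  by (simp_all add: eval_nat_numeral)

lemma E_V3: "first s E \<subseteq> V3" "second s E \<subseteq> V3"
  using tensor_sub_mono[OF E_sub order_refl, of s "tensor_power s 1"]
    tensor_sub_mono[OF order_refl E_sub, of s "tensor_power s 1"]
  by (simp_all only: V3)

lemmas c1_lin = c.lin_on_fst_leg[unfolded V3]
  and c2_lin = c.lin_on_snd_leg[unfolded V3]
  and P1_lin = P.lin_on_fst_leg[unfolded V3]
  and P2_lin = P.lin_on_snd_leg[unfolded V3]

lemma leg_id:
  "z \<in> first s E \<Longrightarrow> fst_leg s E id z = z"
  "z \<in> second s E \<Longrightarrow> snd_leg s E id z = z"
  using i.fst_leg_unique[OF lin_on_id, of z] i.snd_leg_unique[OF lin_on_id, of z] by auto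

text \<open>On \<open>E\<close> the map \<open>c\<close> is -1 times the identity, so its legs are
  compared with those of the identity, supplied by the instance \<open>i\<close>.\<close>

lemma c1_E: "z \<in> first s E \<Longrightarrow> c1 z = - z"
  and c2_E: "z \<in> second s E \<Longrightarrow> c2 z = - z"
  using i.leg_scale_restrict[OF c.leg_axioms E_sub, of "- 1" z] E_c leg_id by auto

lemma P1_E: "z \<in> first s E \<Longrightarrow> P1 z = tscale \<kappa> z"
  and P2_E: "z \<in> second s E \<Longrightarrow> P2 z = tscale \<kappa> z"
  using i.leg_scale_restrict[OF P.leg_axioms E_sub, of \<kappa> z] P_E leg_id by auto

text \<open>The braid equation says that \<open>c1 \<circ> c2\<close> intertwines \<open>c1\<close>
  with \<open>c2\<close>, and \<open>c2 \<circ> c1\<close> intertwines \<open>c2\<close> with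
  \<open>c1\<close>. The same then holds for \<open>h(c1)\<close> and \<open>h(c2)\<close>, which
  are the legs of \<open>h(c)\<close>.\<close>

lemma P1_P2:
  assumes "z \<in> V3"
  shows "c1 (c2 (P1 z)) = P2 (c1 (c2 z))" "c2 (c1 (P2 z)) = P1 (c2 (c1 z))"
proof -
  note sub = subspace_tensor_power[of s 3] and mem = lin_onD(1)[OF c1_lin] lin_onD(1)[OF c2_lin]
  note legs = leg_poly_end[OF c.leg_axioms, unfolded V3]
  have "(c1 \<circ> c2) (poly_end h c1 z) = poly_end h c2 ((c1 \<circ> c2) z)"
    by (rule poly_end_intertwine[OF lin_on_comp[OF c2_lin c1_lin] c1_lin sub _ assms]) (simp add: braid)
  then show "c1 (c2 (P1 z)) = P2 (c1 (c2 z))"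
    using assms by (simp add: legs mem)
  have "(c2 \<circ> c1) (poly_end h c2 z) = poly_end h c1 ((c2 \<circ> c1) z)"
    by (rule poly_end_intertwine[OF lin_on_comp[OF c1_lin c2_lin] c2_lin sub _ assms]) (simp add: braid)
  then show "c2 (c1 (P2 z)) = P1 (c2 (c1 z))"
    using assms by (simp add: legs mem)
qed

text \<open>This makes \<open>c_E2_V\<close> land in \<open>V \<otimes> E2\<close>. As
  \<open>P1\<close> is the scalar \<open>\<kappa>\<close> on \<open>E2 \<otimes> V\<close>, the
  vector \<open>\<kappa> c1 c2 z\<close> equals \<open>P2 (c1 (c2 z))\<close>, and \<open>P2\<close>
  takes values in \<open>V \<otimes> E2\<close>; then divide by \<open>\<kappa>\<close>. No
  description of \<open>V \<otimes> E2\<close> as a kernel is required.\<close>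

lemma c1_c2_E:
  assumes "z \<in> first s E"
  shows "c1 (c2 z) \<in> second s E"
proof -
  have z: "z \<in> V3" using assms E_V3 by blast
  note mem = lin_onD(1)[OF c1_lin] lin_onD(1)[OF c2_lin]
  have "tscale \<kappa> (c1 (c2 z)) = P2 (c1 (c2 z))"
    using P1_P2(1)[OF z] P1_E[OF assms] z mem by (simp add: lin_onD[OF c1_lin] lin_onD[OF c2_lin])
  then have "tscale \<kappa> (c1 (c2 z)) \<in> second s E"
    using lin_onD(1)[OF P2_lin] mem z by simp
  then show ?thesis
    by (rule subspace_scale_cancel[OF subspace_tensor_sub nonzero])
qed

lemma c2_c1_E:
  assumes "z \<in> second s E"
  shows "c2 (c1 z) \<in> first s E"
proof -
  have z: "z \<in> V3" using assms E_V3 by blast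
  note mem = lin_onD(1)[OF c1_lin] lin_onD(1)[OF c2_lin]
  have "tscale \<kappa> (c2 (c1 z)) = P1 (c2 (c1 z))"
    using P1_P2(2)[OF z] P2_E[OF assms] z mem by (simp add: lin_onD[OF c1_lin] lin_onD[OF c2_lin])
  then have "tscale \<kappa> (c2 (c1 z)) \<in> first s E"
    using lin_onD(1)[OF P1_lin] mem z by simp
  then show ?thesis
    by (rule subspace_scale_cancel[OF subspace_tensor_sub nonzero])
qed

section \<open>Transfer of the bracket axioms along \<open>h(c)\<close>\<close>

lemma vec_lin: "Vector_Spaces.linear s tscale (vec s)"
  using linear_pure_tensor[OF vs, of "[]" "[]"] by (simp add: vec_def[abs_def])

lemma vec_comp_lin:
  assumes "b \<in> lin_maps tscale s D UNIV"
  shows "lin_on D (tensor_power s 1) (vec s \<circ> b)"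
proof -
  interpret v: Vector_Spaces.linear s "tscale :: 'k \<Rightarrow> ('k, 'v) tensor \<Rightarrow> _" "vec s" by (rule vec_lin)
  have "vec s v \<in> tensor_power s 1" for v
    by (auto simp: vec_def tensor_power_def intro: T.span_base)
  then show ?thesis
    using assms by (auto simp: lin_on_def lin_maps_def v.add v.scale)
qed

text \<open>An equivalence for any linear \<open>bb\<close> on \<open>E2\<close>: one direction
  shows that the assignment is well defined, the other that the preimage of a lifted bracket is a
  QLie bracket.\<close>

lemma qlie_iff_lifted:
  assumes bb: "bb \<in> lin_maps tscale s E UNIV"
  shows "qlie_algebra s c bb \<longleftrightarrow> lifted_qlie_algebra s c (compose V2 bb P)"
proof -
  define b where "b = compose V2 bb P"
  have bP: "b x = bb (P x)" if "x \<in> V2" for x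
    using that by (simp add: b_def compose_def)
  have bb_scale: "bb (tscale a x) = s a (bb x)" if "x \<in> E" for a x
    using bb that by (simp add: lin_maps_def)
  have bE: "b x = s \<kappa> (bb x)" if "x \<in> E" for x
    using that E_sub P_E bb_scale bP by auto
  have b: "b \<in> lin_maps tscale s V2 UNIV"
    using bb lin_onD[OF P_lin] T.subspace_add[OF subspace_tensor_power[of s 2]]
      T.subspace_scale[OF subspace_tensor_power[of s 2]]
    by (auto simp: lin_maps_def bP simp del: plus_fun_apply) (simp add: b_def compose_def)
  have bc: "b (c x) = - b x" if x: "x \<in> V2" for x
  proof -
    have "P (c x) = c (P x)"
      using poly_end_intertwine[OF c_lin c_lin subspace_tensor_power refl x, of h] by simp
    then have "b (c x) = bb (tscale (- 1) (P x))"
      using x by (simp add: bP lin_onD(1)[OF c_lin] c_poly_end)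
    also have "\<dots> = - b x"
      using x lin_onD(1)[OF P_lin x] by (simp only: bb_scale bP) simp
    finally show ?thesis .
  qed
  interpret v: Vector_Spaces.linear s "tscale :: 'k \<Rightarrow> ('k, 'v) tensor \<Rightarrow> _" "vec s" by (rule vec_lin)
  interpret bb: leg s E "tensor_power s 1" "vec s \<circ> bb" 2 1
    by unfold_locales (use vec_comp_lin[OF bb] E_subspace E_sub in \<open>auto simp: subspace_tensor_power\<close>)
  interpret b: leg s V2 "tensor_power s 1" "vec s \<circ> b" 2 1
    by unfold_locales (use vec_comp_lin[OF b] in \<open>auto simp: subspace_tensor_power\<close>)
  interpret bbP: leg s V2 "tensor_power s 1" "(vec s \<circ> bb) \<circ> P" 2 1
    by unfold_locales (use lin_on_comp[OF P_lin bb.f] in \<open>auto simp: subspace_tensor_power\<close>)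
  let ?bb1 = "fst_leg s E (vec s \<circ> bb)" and ?bb2 = "snd_leg s E (vec s \<circ> bb)"
  let ?b1 = "fst_leg s V2 (vec s \<circ> b)" and ?b2 = "snd_leg s V2 (vec s \<circ> b)"
  have b1_E: "?b1 z = tscale \<kappa> (?bb1 z)" if "z \<in> first s E" for z
    using that bb.leg_scale_restrict(1)[OF b.leg_axioms E_sub] by (simp add: bE v.scale)
  have b2_E: "?b2 z = tscale \<kappa> (?bb2 z)" if "z \<in> second s E" for z
    using that bb.leg_scale_restrict(2)[OF b.leg_axioms E_sub] by (simp add: bE v.scale)
  have b1_P: "?b1 z = ?bb1 (P1 z)" and b2_P: "?b2 z = ?bb2 (P2 z)" if "z \<in> V3" for z
  proof -
    \<comment> \<open>\<open>compose\<close> is extensional, so the two maps are compared on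
      \<open>V2\<close> only; the scalar 1 carries this agreement over to the legs.\<close>
    have "?b1 z = fst_leg s V2 ((vec s \<circ> bb) \<circ> P) z" "?b2 z = snd_leg s V2 ((vec s \<circ> bb) \<circ> P) z"
      using bbP.leg_scale_restrict[OF b.leg_axioms order_refl, of 1 z, unfolded V3] that
      by (simp_all add: bP)
    then show "?b1 z = ?bb1 (P1 z)" "?b2 z = ?bb2 (P2 z)"
      using P.leg_comp[OF bb.leg_axioms, of z, unfolded V3] that by simp_all
  qed
  note mem = lin_onD(1)[OF c1_lin] lin_onD(1)[OF c2_lin]
  have V2: "tensor_sub s (tensor_power s 1) (tensor_power s 1) = V2"
    using tensor_sub_tensor_power[OF vs, of 1 1] by (simp add: eval_nat_numeral)
  note bb_mem = lin_onD(1)[OF bb.lin_on_fst_leg, unfolded V2] lin_onD(1)[OF bb.lin_on_snd_leg, unfolded V2]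
  have cancel: "x = y" if "tscale \<kappa> x = tscale \<kappa> y" for x y :: "('k, 'v) tensor"
    using that nonzero by simp
  \<comment> \<open>Upwards, the condition on \<open>E2 \<otimes> V\<close> is applied to
    \<open>P1 z\<close>, and \<open>P1\<close> is moved past \<open>c1 c2\<close>. Downwards, both
    sides carry a factor \<open>\<kappa>\<close> on \<open>E2 \<otimes> V\<close>, which
    cancels.\<close>
  have 1: "(\<forall>z\<in>first s E. c (?bb1 z) = ?bb2 (c1 (c2 z))) \<longleftrightarrow> (\<forall>z\<in>V3. c (?b1 z) = ?b2 (c1 (c2 z)))"
  proof (intro iffI ballI)
    fix z assume "\<forall>z\<in>first s E. c (?bb1 z) = ?bb2 (c1 (c2 z))" "z \<in> V3"
    then show "c (?b1 z) = ?b2 (c1 (c2 z))"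
      using lin_onD(1)[OF P1_lin] by (simp add: b1_P b2_P mem P1_P2)
  next
    fix z assume *: "\<forall>z\<in>V3. c (?b1 z) = ?b2 (c1 (c2 z))" and z: "z \<in> first s E"
    then have "c (?b1 z) = ?b2 (c1 (c2 z))" using E_V3 by blast
    then show "c (?bb1 z) = ?bb2 (c1 (c2 z))"
      by - (rule cancel, simp only: b1_E[OF z] b2_E[OF c1_c2_E[OF z]] lin_onD[OF c_lin bb_mem(1)[OF z]])
  qed
  have 2: "(\<forall>z\<in>second s E. c (?bb2 z) = ?bb1 (c2 (c1 z))) \<longleftrightarrow> (\<forall>z\<in>V3. c (?b2 z) = ?b1 (c2 (c1 z)))"
  proof (intro iffI ballI)
    fix z assume "\<forall>z\<in>second s E. c (?bb2 z) = ?bb1 (c2 (c1 z))" "z \<in> V3"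
    then show "c (?b2 z) = ?b1 (c2 (c1 z))"
      using lin_onD(1)[OF P2_lin] by (simp add: b1_P b2_P mem P1_P2)
  next
    fix z assume *: "\<forall>z\<in>V3. c (?b2 z) = ?b1 (c2 (c1 z))" and z: "z \<in> second s E"
    then have "c (?b2 z) = ?b1 (c2 (c1 z))" using E_V3 by blast
    then show "c (?bb2 z) = ?bb1 (c2 (c1 z))"
      by - (rule cancel, simp only: b2_E[OF z] b1_E[OF c2_c1_E[OF z]] lin_onD[OF c_lin bb_mem(2)[OF z]])
  qed
  \<comment> \<open>The two sides differ by \<open>\<kappa>\<close> squared: one factor comes from
    the legs, the other from \<open>b\<close> on \<open>E\<close>. The second needs the difference
    to lie in \<open>E\<close>, which the compatibility conditions ensure: \<open>c1 c2\<close> and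
    \<open>c2 c1\<close> fix \<open>z\<close>, so \<open>c\<close> swaps \<open>?bb1 z\<close> and
    \<open>?bb2 z\<close>.\<close>
  have 3: "b (?b1 z - ?b2 z) = 0 \<longleftrightarrow> bb (?bb1 z - ?bb2 z) = 0"
    if c12: "\<forall>z\<in>first s E. c (?bb1 z) = ?bb2 (c1 (c2 z))" "\<forall>z\<in>second s E. c (?bb2 z) = ?bb1 (c2 (c1 z))"
      and z: "z \<in> first s E" "z \<in> second s E" for z
  proof -
    have z3: "z \<in> V3" using z E_V3 by blast
    have "c1 (c2 z) = z" "c2 (c1 z) = z"
      by (simp_all only: c1_E[OF z(1)] c2_E[OF z(2)] lin_on_uminus[OF c1_lin z3]
          lin_on_uminus[OF c2_lin z3] minus_minus)
    then have swap: "c (?bb1 z) = ?bb2 z" "c (?bb2 z) = ?bb1 z"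
      using bspec[OF c12(1) z(1)] bspec[OF c12(2) z(2)] by simp_all
    have d: "?bb1 z - ?bb2 z = ?bb1 z + tscale (- 1) (?bb2 z)" by simp
    have "c (?bb1 z - ?bb2 z) = - (?bb1 z - ?bb2 z)"
      unfolding d using z
      by (simp only: lin_onD[OF c_lin] bb_mem swap T.subspace_scale[OF subspace_tensor_power]) simp
    then have E: "?bb1 z - ?bb2 z \<in> E"
      using z by (intro E_I T.subspace_diff[OF subspace_tensor_power] bb_mem)
    have "?b1 z - ?b2 z = tscale \<kappa> (?bb1 z - ?bb2 z)"
      using z by (simp only: b1_E b2_E T.scale_right_diff_distrib)
    then have "b (?b1 z - ?b2 z) = s \<kappa> (s \<kappa> (bb (?bb1 z - ?bb2 z)))"
      using E T.subspace_scale[OF E_subspace E] by (simp only: bE bb_scale)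
    then show ?thesis using nonzero by simp
  qed
  have "qlie_algebra s c bb \<longleftrightarrow>
      (\<forall>z\<in>first s E. c (?bb1 z) = ?bb2 (c1 (c2 z))) \<and>
      (\<forall>z\<in>second s E. c (?bb2 z) = ?bb1 (c2 (c1 z))) \<and>
      (\<forall>z\<in>first s E \<inter> second s E. bb (?bb1 z - ?bb2 z) = 0)"
    using braided bb
    by (simp add: qlie_algebra_def Let_def E2_V_def V_E2_def E2_bar_def c_E2_V_def c_V_E2_def)
  \<comment> \<open>The third clause is exchanged first, while the first two still speak of
    \<open>bb\<close>, as \<open>3\<close> assumes them in that form.\<close>
  also have "\<dots> \<longleftrightarrow>
      (\<forall>z\<in>first s E. c (?bb1 z) = ?bb2 (c1 (c2 z))) \<and>
      (\<forall>z\<in>second s E. c (?bb2 z) = ?bb1 (c2 (c1 z))) \<and>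
      (\<forall>z\<in>first s E \<inter> second s E. b (?b1 z - ?b2 z) = 0)"
    using 3 by blast
  also have "\<dots> \<longleftrightarrow> lifted_qlie_algebra s c b"
    unfolding 1 2 lifted_qlie_algebra_def Let_def E2_bar_def E2_V_def V_E2_def
    using braided b bc by blast
  finally show ?thesis unfolding b_def .
qed

text \<open>The preimage is \<open>\<kappa>\<close> inverse times \<open>b\<close>, restricted to
  \<open>E\<close>. The relation \<open>b c = -b\<close> gives \<open>b P = \<kappa> b\<close>, and
  \<open>P x\<close> lies in \<open>E\<close>, so composing with \<open>P\<close> recovers
  \<open>b\<close>.\<close>

lemma compose_inverse:
  assumes "b \<in> lin_maps tscale s V2 UNIV" "\<And>x. x \<in> V2 \<Longrightarrow> b (c x) = - b x"
  obtains bb where "bb \<in> lin_maps tscale s E UNIV" "compose V2 bb P = b"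
proof -
  define bb where "bb = restrict (\<lambda>x. s (inverse \<kappa>) (b x)) E"
  have b: "b (x + y) = b x + b y" "b (tscale a x) = s a (b x)" if "x \<in> V2" "y \<in> V2" for x y a
    using assms(1) that by (auto simp: lin_maps_def)
  have E: "x \<in> E \<Longrightarrow> x \<in> V2" for x using E_sub by blast
  have bb: "bb \<in> lin_maps tscale s E UNIV"
    using T.subspace_add[OF E_subspace] T.subspace_scale[OF E_subspace]
    by (auto simp: lin_maps_def bb_def b(1) b(2)[OF E E] E V.scale_right_distrib mult.commute
        simp del: plus_fun_apply)
  have "b (P x) = s \<kappa> (b x)" if x: "x \<in> V2" for x
  proof -
    have mem: "(c ^^ i) x \<in> V2" for i
      using lin_onD(1)[OF lin_on_funpow[OF c_lin] x] .
    have pow: "b ((c ^^ i) x) = s ((- 1) ^ i) (b x)" for i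
      by (induction i) (auto simp: assms(2) mem)
    \<comment> \<open>\<open>lin_on_sum\<close> concerns tensor-valued maps, whereas
      \<open>b\<close> takes values in the space of vectors, so linearity over sums is proved here
      by induction.\<close>
    have "b (\<Sum>i\<in>I. tscale (coeff h i) ((c ^^ i) x)) = (\<Sum>i\<in>I. s (coeff h i) (b ((c ^^ i) x)))"
      if "finite I" for I
      using that
    proof induction
      case empty
      show ?case using b(2)[OF x x, of 0] by (simp del: zero_fun_apply)
    next
      case (insert j I)
      have "(\<Sum>i\<in>I. tscale (coeff h i) ((c ^^ i) x)) \<in> V2" "tscale (coeff h j) ((c ^^ j) x) \<in> V2"
        by (auto intro!: T.subspace_sum[OF subspace_tensor_power] T.subspace_scale[OF subspace_tensor_power] mem)
      with insert show ?case
        by (simp only: sum.insert[OF insert(1,2)] b mem)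
    qed
    then show ?thesis
      by (simp add: poly_end_def pow poly_altdef V.scale_sum_left)
  qed
  \<comment> \<open>Outside \<open>V2\<close> both sides are \<open>undefined\<close>, since both
    functions are extensional.\<close>
  then have "compose V2 bb P x = b x" for x
    using lin_onD(1)[OF P_lin] nonzero assms(1)
    by (cases "x \<in> V2") (auto simp: compose_def bb_def lin_maps_def)
  then have "compose V2 bb P = b" by blast
  with bb that show thesis by blast
qed

lemma bij_betw_qlie_lifted:
  "bij_betw (\<lambda>\<beta>. compose V2 \<beta> P) {\<beta>. qlie_algebra s c \<beta>} {\<beta>. lifted_qlie_algebra s c \<beta>}"
  unfolding bij_betw_def
proof
  have lin: "\<beta> \<in> lin_maps tscale s E UNIV" if "qlie_algebra s c \<beta>" for \<beta>
    using that by (simp add: qlie_algebra_def)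
  show "inj_on (\<lambda>\<beta>. compose V2 \<beta> P) {\<beta>. qlie_algebra s c \<beta>}"
  proof (rule inj_onI, clarsimp)
    fix \<beta> \<gamma> assume q: "qlie_algebra s c \<beta>" "qlie_algebra s c \<gamma>" and eq: "compose V2 \<beta> P = compose V2 \<gamma> P"
    show "\<beta> = \<gamma>"
    proof (rule extensionalityI[of _ E])
      show "\<beta> \<in> extensional E" "\<gamma> \<in> extensional E"
        using lin[OF q(1)] lin[OF q(2)] by (auto simp: lin_maps_def PiE_def)
      fix x assume x: "x \<in> E"
      then have "\<beta> (P x) = \<gamma> (P x)"
        using fun_cong[OF eq, of x] E_sub by (auto simp: compose_def)
      \<comment> \<open>On \<open>E\<close> the map \<open>P\<close> is the nonzero scalar
        \<open>\<kappa>\<close>, so a bracket can be read off from its composite with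
        \<open>P\<close>.\<close>
      then have "s \<kappa> (\<beta> x) = s \<kappa> (\<gamma> x)"
        using lin[OF q(1)] lin[OF q(2)] x by (simp add: P_E lin_maps_def)
      then show "\<beta> x = \<gamma> x" using nonzero by simp
    qed
  qed
  show "(\<lambda>\<beta>. compose V2 \<beta> P) ` {\<beta>. qlie_algebra s c \<beta>} = {\<beta>. lifted_qlie_algebra s c \<beta>}"
  proof (intro subset_antisym subsetI)
    fix \<beta> assume "\<beta> \<in> {\<beta>. lifted_qlie_algebra s c \<beta>}"
    then have l: "lifted_qlie_algebra s c \<beta>" by simp
    then have "\<beta> \<in> lin_maps tscale s V2 UNIV" "\<And>x. x \<in> V2 \<Longrightarrow> \<beta> (c x) = - \<beta> x"
      by (simp_all add: lifted_qlie_algebra_def Let_def)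
    then obtain \<gamma> where "\<gamma> \<in> lin_maps tscale s E UNIV" "compose V2 \<gamma> P = \<beta>"
      by (rule compose_inverse)
    then show "\<beta> \<in> (\<lambda>\<beta>. compose V2 \<beta> P) ` {\<beta>. qlie_algebra s c \<beta>}"
      using qlie_iff_lifted l by blast
  next
    fix \<gamma> assume "\<gamma> \<in> (\<lambda>\<beta>. compose V2 \<beta> P) ` {\<beta>. qlie_algebra s c \<beta>}"
    then obtain \<beta> where "\<gamma> = compose V2 \<beta> P" "qlie_algebra s c \<beta>" by blast
    then show "\<gamma> \<in> {\<beta>. lifted_qlie_algebra s c \<beta>}"
      using qlie_iff_lifted[OF lin] by simp
  qed
qed

end

theorem lemma3p15:
  fixes s :: "'k::field \<Rightarrow> 'v::ab_group_add \<Rightarrow> 'v"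
    and c :: "('k, 'v) tensor \<Rightarrow> ('k, 'v) tensor"
    and f h :: "'k poly"
  assumes "braided_vector_space s c"
    and "f \<noteq> 0" and "order (- 1) f = 1"
    and "\<forall>x \<in> tensor_power s 2. poly_end f c x = 0"
    and "f = [:1, 1:] * h"
  shows "bij_betw (\<lambda>\<beta>. compose (tensor_power s 2) \<beta> (poly_end h c))
           {\<beta>. qlie_algebra s c \<beta>} {\<beta>. lifted_qlie_algebra s c \<beta>}"
proof -
  interpret split_braiding s c h
  proof
    have c: "lin_on (tensor_power s 2) (tensor_power s 2) c"
      using assms(1) by (auto simp: braided_vector_space_def intro: lin_maps_lin_on)
    show "c (poly_end h c x) = - poly_end h c x" if x: "x \<in> tensor_power s 2" for x
    proof -
      have "poly_end h c x + c (poly_end h c x) = 0"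
        using assms(4) x poly_end_X_plus_1[OF c subspace_tensor_power x, of h] unfolding assms(5) by metis
      then show ?thesis by (metis add_eq_0_iff)
    qed
    show "poly h (- 1) \<noteq> 0"
    proof
      assume "poly h (- 1) = 0"
      then have "[:1, 1:] dvd h"
        using poly_eq_0_iff_dvd[of h "- 1"] by simp
      \<comment> \<open>A second factor X + 1, coming from \<open>h\<close>, would raise the order
        of the root -1 of the nonzero \<open>f\<close> to at least 2. The linear factor is written
        in the shape that \<open>order_divides\<close> expects.\<close>
      then have "[:- (- 1), 1:] ^ 2 dvd f"
        unfolding assms(5) power2_eq_square minus_minus by (rule mult_dvd_mono[OF dvd_refl])
      then have "2 \<le> order (- 1) f" using order_divides assms(2) by blast
      then show False using assms(3) by simp
    qed
  qed (rule assms(1))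
  show ?thesis by (rule bij_betw_qlie_lifted)
qed

end
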